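(* For every $\alpha\in\mathbb{C}$ with $\mathfrak{Re}(\alpha)>0$, $$\begin{aligned} I_{1^-}^\alpha\log\Gamma(0)&=\frac{1}{\Gamma(\alpha+1)}\Big(\log\pi-\int_{0}^{1}\alpha t^{\alpha-1}\log\sin(\pi t)\,dt\Big)-I_{0^+}^\alpha\log\Gamma(1)\\ &=\frac{1}{\Gamma(\alpha+1)}\Big(\sum_{n=1}^{\infty}(-1)^{n}\binom{\alpha}{n}\sum_{k=0}^{n-1}(-1)^k\binom{n}{k}\log D_k+\log\pi-\int_{0}^{1}\alpha t^{\alpha-1}\log\sin(\pi t)\,dt\Big).\end{aligned}$$
   Context: $\Gamma$ is Euler's gamma function. For $\mathfrak{Re}(\alpha)>0$ the left- and right-sided Riemann-Liouville fractional integrals of order $\alpha$ of $f$ on $[a,b]$ are $I_{a^+}^\alpha f(x)=\frac{1}{\Gamma(\alpha)}\int_a^x (x-t)^{\alpha-1}f(t)\,dt$ ($a<x\le b$) and $I_{b^-}^\alpha f(x)=\frac{1}{\Gamma(\alpha)}\int_x^b (t-x)^{\alpha-1}f(t)\,dt$ ($a\le x<b$). Here they are applied with $a=0$, $b=1$ and $f(t)=\log\Gamma(t)$ (real logarithm, $t\in(0,1]$), so $I_{0^+}^\alpha\log\Gamma(1)=\frac{1}{\Gamma(\alpha)}\int_0^1(1-t)^{\alpha-1}\log\Gamma(t)\,dt$ and $I_{1^-}^\alpha\log\Gamma(0)=\frac{1}{\Gamma(\alpha)}\int_0^1 t^{\alpha-1}\log\Gamma(t)\,dt$. For positive real $y$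 and complex $s$, $y^s=e^{s\log y}$. Generalized binomial coefficient: $\binom{\alpha}{n}=\frac{\alpha(\alpha-1)\cdots(\alpha-n+1)}{n!}$. Generalized Glaisher constants $D_k>0$, $k=0,1,2,\dots$, are defined by $$\log D_k=\lim_{n\to\infty}\Big(\sum_{m=1}^n m^k\log m-p(n,k)\Big),$$ $$p(n,k)=\frac{n^k\log n}{2}+\frac{n^{k+1}}{k+1}\Big(\log n-\frac{1}{k+1}\Big)+k!\sum_{m=1}^{k}\frac{n^{k-m}B_{m+1}}{(m+1)!(k-m)!}\Big(\log n+(1-\delta_{km})\sum_{l=1}^{m}\frac{1}{k-l+1}\Big),$$ where $\delta_{km}$ is the Kronecker delta, empty sums are $0$, and $B_j$ are the Bernoulli numbers given by $\frac{t}{e^t-1}=\sum_{j\ge0}B_j\frac{t^j}{j!}$ for $|t|<2\pi$. *)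

theory Defs
  imports "HOL-Complex_Analysis.Complex_Analysis"
begin

text \<open>
  Integrals are Lebesgue integrals over the closed interval; values at the endpoints, where
  the integrands may be singular and take the library's default values, are irrelevant.
  The fractional integrals are meant for \<^term>\<open>Re \<alpha> > 0\<close> and \<^term>\<open>a < x\<close>
  (respectively \<^term>\<open>x < b\<close>).
\<close>

definition RL_integral_left :: "real \<Rightarrow> complex \<Rightarrow> (real \<Rightarrow> complex) \<Rightarrow> real \<Rightarrow> complex" where
  "RL_integral_left a \<alpha> f x =
     1 / Gamma \<alpha> * (LINT t:{a..x}|lborel. complex_of_real (x - t) powr (\<alpha> - 1) * f t)"

definition RL_integral_right :: "real \<Rightarrow> complex \<Rightarrow> (real \<Rightarrow> complex) \<Rightarrow> real \<Rightarrow> complex" where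
  "RL_integral_right b \<alpha> f x =
     1 / Gamma \<alpha> * (LINT t:{x..b}|lborel. complex_of_real (t - x) powr (\<alpha> - 1) * f t)"

definition log_Gamma :: "real \<Rightarrow> complex" where
  "log_Gamma t = complex_of_real (ln (Gamma t))"

text \<open>
  Bernoulli numbers, read off from the exponential generating function $t/(e^t-1)$ as a
  formal power series (so $B_1 = -1/2$); \<open>bernoulli_num_sums\<close> below is the analytic version.
\<close>

definition bernoulli_num :: "nat \<Rightarrow> real" where
  "bernoulli_num j = fact j * fps_nth (fps_X / (fps_exp 1 - 1)) j"

lemma bernoulli_num_sums:
  fixes t :: complex
  assumes "t \<noteq> 0" "norm t < 2 * pi"
  shows "(\<lambda>j. of_real (bernoulli_num j) * t ^ j / fact j) sums (t / (exp t - 1))"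
proof -
  let ?E = "fps_exp 1 - 1 :: complex fps" and ?Er = "fps_exp 1 - 1 :: real fps"
  define F where "F = fps_X / ?E"
  define G where "G = (fps_X / ?Er :: real fps)"
  have nz: "?E \<noteq> 0" "?Er \<noteq> 0"
    by (auto simp: fps_eq_iff intro!: exI[of _ 1])
  have sd: "subdegree ?E = 1" "subdegree ?Er = 1"
    by (auto intro!: subdegreeI)
  have le: "subdegree ?E \<le> subdegree (fps_X :: complex fps)" "?Er dvd fps_X"
    by (simp_all only: fps_dvd_iff[OF nz(2) fps_X_neq_zero] sd subdegree_fps_X order_refl)
  have "G * ?Er = fps_X"
    unfolding G_def by (rule dvd_div_mult_self[OF le(2)])
  hence G: "(\<Sum>i=0..n. fps_nth G i * fps_nth ?Er (n - i)) = fps_nth fps_X n" for n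
    by (metis fps_mult_nth)
  have "Abs_fps (\<lambda>n. complex_of_real (fps_nth G n)) * ?E = fps_X"
  proof (rule fps_ext)
    fix n
    have E: "fps_nth ?E i = of_real (fps_nth ?Er i)" for i
      by simp
    have "fps_nth (Abs_fps (\<lambda>n. complex_of_real (fps_nth G n)) * ?E) n =
            of_real (\<Sum>i=0..n. fps_nth G i * fps_nth ?Er (n - i))"
      unfolding fps_mult_nth E of_real_sum of_real_mult by simp
    also have "\<dots> = fps_nth fps_X n"
      unfolding G by simp
    finally show "fps_nth (Abs_fps (\<lambda>n. complex_of_real (fps_nth G n)) * ?E) n = fps_nth fps_X n" .
  qed
  hence "Abs_fps (\<lambda>n. complex_of_real (fps_nth G n)) = F"
    unfolding F_def using nz(1) by (metis nonzero_mult_div_cancel_right)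
  hence FG: "fps_nth F j = of_real (fps_nth G j)" for j
    by (metis fps_nth_Abs_fps)
  have zero_free: "eval_fps ?E z \<noteq> 0" if z: "z \<in> eball 0 (ereal (2 * pi))" "z \<noteq> 0" for z
  proof
    assume "eval_fps ?E z = 0"
    hence "exp z = 1" by (simp add: eval_fps_diff)
    then obtain n :: int where n: "Re z = 0" "Im z = of_int (2 * n) * pi"
      unfolding exp_eq_1 by blast
    have "norm z < 2 * pi" using z(1) by simp
    moreover have "norm z = \<bar>Im z\<bar>" using n(1) by (simp add: cmod_def)
    ultimately have "\<bar>real_of_int n\<bar> * (2 * pi) < 1 * (2 * pi)"
      using n(2) by (simp add: abs_mult mult_ac)
    hence "\<bar>real_of_int n\<bar> < 1" by (subst (asm) mult_less_cancel_right) auto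
    hence "n = 0" by linarith
    with n z(2) show False by (simp add: complex_eq_iff)
  qed
  have rE: "fps_conv_radius ?E = \<infinity>"
    using fps_conv_radius_diff[of "fps_exp 1" "1 :: complex fps"] by simp
  have R: "Min {ereal (2 * pi), fps_conv_radius (fps_X :: complex fps), fps_conv_radius ?E} = 2 * pi"
    by (simp add: rE min_def)
  note * = fps_conv_radius_divide[OF le(1), of "ereal (2 * pi)"]
    eval_fps_divide[OF le(1), of "ereal (2 * pi)" t, OF _ _ _ _ _ refl]
  have "fps_conv_radius F \<ge> 2 * pi"
    unfolding F_def using *(1) zero_free R by (simp add: rE)
  moreover have ev: "eval_fps F t = t / (exp t - 1)"
    unfolding F_def using *(2) zero_free R assms by (simp add: rE eval_fps_diff)
  ultimately have "(\<lambda>j. fps_nth F j * t ^ j) sums eval_fps F t"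
    using assms(2) by (intro sums_eval_fps) (meson ereal_less(4) less_ereal.simps(1) less_le_trans)
  moreover have "fps_nth F j * t ^ j = of_real (bernoulli_num j) * t ^ j / fact j" for j
    by (simp add: FG G_def bernoulli_num_def)
  ultimately show ?thesis by (simp add: ev)
qed

definition glaisher_p :: "nat \<Rightarrow> nat \<Rightarrow> real" where
  "glaisher_p n k =
     real n ^ k * ln (real n) / 2 +
     real n ^ (k + 1) / real (k + 1) * (ln (real n) - 1 / real (k + 1)) +
     fact k * (\<Sum>m=1..k. real n ^ (k - m) * bernoulli_num (m + 1) / (fact (m + 1) * fact (k - m)) *
       (ln (real n) + (1 - of_bool (k = m)) * (\<Sum>l=1..m. 1 / (real k - real l + 1))))"

definition glaisher_D :: "nat \<Rightarrow> real" where
  "glaisher_D k = exp (lim (\<lambda>n. (\<Sum>m=1..n. real m ^ k * ln (real m)) - glaisher_p n k))"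

end

theory Submission
  imports Defs "HOL-Real_Asymp.Real_Asymp"
begin

text \<open>
  The first equality is Euler's reflection formula. Substituting $t \mapsto 1 - t$ turns the left-sided
  integral into $\int_0^1 t^{\alpha-1} \log\Gamma(1-t)\,dt$ (up to $1/\Gamma(\alpha)$), and
  $\log\Gamma(t) + \log\Gamma(1-t) = \log\pi - \log\sin(\pi t)$. All integrals converge because
  $0 \le \log\Gamma(t) \le -\log t$ on $(0,1]$ (\<open>ln_Gamma_bounds_unit_interval\<close>).

  For the second equality, $(1-t)^{\alpha-1}$ is expanded in its binomial series and integrated termwise
  (\<open>one_minus_powr_ln_Gamma_series\<close>). The same bound gives moments of size $O(1/m^2)$,
  and the binomial coefficients are bounded since $\Re(\alpha) > 0$, so the series converges absolutely
  in the whole half plane. The absorption identity $n {\alpha \choose n} = \alpha {\alpha - 1 \choose n-1}$ then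
  reduces everything to the evaluation of moments (\<open>ln_Gamma_moment_eq_glaisher\<close>)
  $$\int_0^1 n t^{n-1} \log\Gamma(t)\,dt = \sum_{k<n} (-1)^k {n \choose k} \log D_k.$$

  To obtain it, $\log\Gamma(t)$ is written as $\log\Gamma(N+t) - \sum_{j<N} \log(j+t)$. The
  integrals of $n t^{n-1} \log(j+t)$ are elementary, and summing them over $j$ yields the sums
  $\sum_{m \le N} m^k \log m$ with coefficients $(-1)^k {n \choose k}$, whereas log-convexity controls
  $\log\Gamma(N+t)$ up to an error tending to $0$ (\<open>ln_Gamma_moment_approx\<close>). By the
  Euler--Maclaurin formula these sums are $\log D_k + p(N,k) + o(1)$
  (\<open>glaisher_D_limit\<close>). All that remains besides the constants has the form
  $P(N) \log N + Q(N)$ with polynomials satisfying $Q(0) = 0$, and since it converges, it vanishes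
  (\<open>poly_ln_convergent_imp_const\<close>).
\<close>

section \<open>The logarithm of the Gamma function\<close>

lemma convex_on_ln_Gamma_Icc:
  fixes x y :: real
  assumes "x > 0"
  shows "convex_on {x..y} (\<lambda>x. ln (Gamma x))"
proof -
  have "{x..y} \<subseteq> {0<..}" using assms by auto
  from convex_on_subset[OF log_convex_Gamma_real this] show ?thesis
    by (simp add: o_def)
qed

text \<open>
  Convexity together with $\log\Gamma(1) = \log\Gamma(2) = 0$ forces
  $\log\Gamma \ge 0$ to the left of $1$ and $\log\Gamma \le 0$ on $[1,2]$; the functional equation turns
  the latter into the upper bound. The comparison function \<^term>\<open>- ln t\<close> serves both as
  an integrable majorant near $0$ and as a first-order zero near $1$.
\<close>

lemma ln_Gamma_bounds_unit_interval:
  fixes t :: real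
  assumes "0 < t" "t \<le> 1"
  shows "0 \<le> ln (Gamma t)" "ln (Gamma t) \<le> - ln t"
proof -
  have [simp]: "Gamma (2::real) = 1"
    using Gamma_fact[of 1, where 'a = real] by simp
  show "0 \<le> ln (Gamma t)"
  proof -
    have "ln (Gamma 1) \<le> (ln (Gamma t) - ln (Gamma 2)) / (2 - t) * (2 - 1) + ln (Gamma (2::real))"
      using assms by (intro convex_onD_Icc'' convex_on_ln_Gamma_Icc) auto
    thus ?thesis using assms by (simp add: zero_le_divide_iff)
  qed
  have "ln (Gamma (t + 1)) \<le> (ln (Gamma 2) - ln (Gamma 1)) / (2 - 1) * (t + 1 - 1) + ln (Gamma (1::real))"
    using assms by (intro convex_onD_Icc' convex_on_ln_Gamma_Icc) auto
  moreover have "ln (Gamma (t + 1)) = ln t + ln (Gamma t)"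
    using assms by (subst Gamma_plus1) (auto elim!: nonpos_Ints_cases simp: ln_mult_pos)
  ultimately show "ln (Gamma t) \<le> - ln t" by simp
qed

lemma ln_Gamma_add_nat:
  fixes t :: real
  assumes "t > 0"
  shows "ln (Gamma t) = ln (Gamma (real N + t)) - (\<Sum>j<N. ln (real j + t))"
proof (induction N)
  case (Suc N)
  have "Gamma (real (Suc N) + t) = (real N + t) * Gamma (real N + t)"
  proof -
    have "real N + t \<notin> \<int>\<^sub>\<le>\<^sub>0"
      using assms by (auto elim!: nonpos_Ints_cases)
    thus ?thesis using Gamma_plus1[of "real N + t"] by (simp add: add_ac)
  qed
  hence "ln (Gamma (real (Suc N) + t)) = ln (real N + t) + ln (Gamma (real N + t))"
    using assms by (simp add: ln_mult_pos add_nonneg_pos)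
  with Suc show ?case by simp
qed simp

text \<open>
  By convexity the graph over $[N, N+1]$ lies below its chord, whose slope is $\log N$, and above the
  extension of the chord over $[N-1, N]$, whose slope is $\log (N-1)$. The error is thus uniform
  in $t$, so it can be integrated without any convergence theorem.
\<close>

lemma ln_Gamma_large_approx:
  fixes t :: real
  assumes "0 \<le> t" "t \<le> 1" "N \<ge> 2"
  shows "\<bar>ln (Gamma (real N + t)) - (ln (fact (N - 1)) + t * ln (real N))\<bar>
           \<le> ln (real N) - ln (real N - 1)"
proof -
  obtain M where N: "N = Suc (Suc M)"
    using assms(3) by (metis Suc_le_D numeral_2_eq_2 Suc_le_mono)
  have G: "Gamma (real N) = fact (N - 1)" "Gamma (1 + real N) = real N * fact (N - 1)"
     "Gamma (real N - 1) = fact (N - 1) / (real N - 1)"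
    using Gamma_fact[of "Suc M", where 'a = real] Gamma_fact[of "Suc (Suc M)", where 'a = real]
      Gamma_fact[of "M", where 'a = real]
    by (simp_all add: N field_simps)
  have "ln (Gamma (real N + t)) \<le> (ln (Gamma (real N + 1)) - ln (Gamma (real N))) /
          (real N + 1 - real N) * (real N + t - real N) + ln (Gamma (real N))"
    using assms by (intro convex_onD_Icc' convex_on_ln_Gamma_Icc) auto
  hence upper: "ln (Gamma (real N + t)) \<le> ln (fact (N - 1)) + t * ln (real N)"
    using assms(3) by (simp add: G(1) G(2) ln_mult_pos algebra_simps)
  have "ln (Gamma (real N)) \<le> (ln (Gamma (real N + t)) - ln (Gamma (real N - 1))) /
          (real N + t - (real N - 1)) * (real N - (real N - 1)) + ln (Gamma (real N - 1))"
    using assms by (intro convex_onD_Icc' convex_on_ln_Gamma_Icc) auto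
  moreover have "ln (Gamma (real N - 1)) = ln (fact (N - 1)) - ln (real N - 1)"
    using assms(3) by (simp add: G ln_div)
  ultimately have "ln (real N - 1) \<le> (ln (Gamma (real N + t)) - ln (fact (N - 1)) + ln (real N - 1)) / (1 + t)"
    by (simp add: G(1) algebra_simps)
  hence lower: "ln (Gamma (real N + t)) \<ge> ln (fact (N - 1)) + t * ln (real N - 1)"
    using assms by (simp add: field_simps)
  have "ln (real N - 1) \<le> ln (real N)" using assms by simp
  hence "t * (ln (real N) - ln (real N - 1)) \<le> 1 * (ln (real N) - ln (real N - 1))"
    using assms by (intro mult_right_mono) auto
  thus ?thesis using upper lower by (simp add: algebra_simps)
qed

lemma ln_sin_pi_eq_ln_Gamma:
  fixes t :: real
  assumes "0 < t" "t < 1"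
  shows "ln (sin (pi * t)) = ln pi - ln (Gamma t) - ln (Gamma (1 - t))"
proof -
  have "complex_of_real (Gamma t * Gamma (1 - t)) = complex_of_real (pi / sin (pi * t))"
    using Gamma_reflection_complex[of "of_real t"]
    by (simp flip: Gamma_complex_of_real sin_of_real)
  hence eq: "Gamma t * Gamma (1 - t) = pi / sin (pi * t)"
    by (simp only: of_real_eq_iff)
  have pos: "sin (pi * t) > 0"
    using assms by (intro sin_gt_zero) auto
  have "ln (Gamma t) + ln (Gamma (1 - t)) = ln (pi / sin (pi * t))"
    using Gamma_real_pos[of t] Gamma_real_pos[of "1 - t"] assms
    by (subst eq [symmetric], subst ln_mult_pos) auto
  also have "\<dots> = ln pi - ln (sin (pi * t))"
    using pos by (simp add: ln_div)
  finally show ?thesis by simp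
qed

section \<open>Integrals over the unit interval\<close>

text \<open>
  The logarithmic singularities sit at the endpoints, so all estimates are made on the open
  interval.
\<close>

lemma set_integral_Icc_eq_open:
  fixes f :: "real \<Rightarrow> 'a :: {banach, second_countable_topology}"
  shows "(LINT t:{0..1}|lborel. f t) = (LINT t:{0<..<1}|lborel. f t)"
  using interval_integral_Icc[of 0 1 f] interval_integral_Ioo[of 0 1 f]
  by (simp add: zero_ereal_def one_ereal_def)

lemma set_integral_reflect_unit_interval:
  fixes f :: "real \<Rightarrow> 'a :: {banach, second_countable_topology}"
  shows "(LINT t:{0<..<1}|lborel. f (1 - t)) = (LINT t:{0<..<1}|lborel. f t)"
    and "set_integrable lborel {0<..<1} (\<lambda>t. f (1 - t)) \<longleftrightarrow> set_integrable lborel {0<..<1} f"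
proof -
  have ind: "indicator {0<..<1} (1 - t) = (indicator {0<..<1} t :: real)" for t :: real
    by (auto simp: indicator_def)
  show "(LINT t:{0<..<1}|lborel. f (1 - t)) = (LINT t:{0<..<1}|lborel. f t)"
    using lborel_integral_real_affine[of "-1" "\<lambda>t. indicator {0<..<1} t *\<^sub>R f t" 1]
    by (simp add: set_lebesgue_integral_def ind)
  show "set_integrable lborel {0<..<1} (\<lambda>t. f (1 - t)) \<longleftrightarrow> set_integrable lborel {0<..<1} f"
    using lborel_integrable_real_affine_iff[of "-1" "\<lambda>t. indicator {0<..<1} t *\<^sub>R f t" 1]
    by (simp add: set_integrable_def ind)
qed

text \<open>
  The antiderivative of the integrand is $t^s/s^2 - t^s \log t / s$, which extends continuously by $0$
  to $t = 0$ because $s > 0$.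
\<close>

lemma powr_neg_ln_integral:
  fixes s :: real
  assumes "s > 0"
  shows "set_integrable lborel {0<..<1} (\<lambda>t. t powr (s - 1) * (- ln t))"
    and "(LINT t:{0<..<1}|lborel. t powr (s - 1) * (- ln t)) = 1 / s\<^sup>2"
proof -
  let ?F = "\<lambda>t. t powr s / s\<^sup>2 - t powr s * ln t / s"
  have D: "(?F has_real_derivative t powr (s - 1) * (- ln t)) (at t)" if "t > 0" for t
  proof -
    have "t powr s = t powr (s - 1) * t"
      using that by (simp add: powr_diff)
    thus ?thesis using that assms
      by (auto intro!: derivative_eq_intros simp: field_simps power2_eq_square)
  qed
  have C: "isCont (\<lambda>t. t powr (s - 1) * (- ln t)) t" if "t > 0" for t
    using that by (intro continuous_intros) auto
  have lim0: "((?F \<circ> real_of_ereal) \<longlongrightarrow> 0) (at_right 0)"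
  proof -
    have "(?F \<longlongrightarrow> 0) (at_right 0)"
      using assms by real_asymp
    thus ?thesis by (auto simp: zero_ereal_def ereal_tendsto_simps)
  qed
  have lim1: "((?F \<circ> real_of_ereal) \<longlongrightarrow> 1 / s\<^sup>2) (at_left 1)"
  proof -
    have "(?F \<longlongrightarrow> ?F 1) (at_left 1)"
      using assms by (intro tendsto_intros) auto
    thus ?thesis by (auto simp: one_ereal_def ereal_tendsto_simps)
  qed
  have nn: "AE x in lborel. 0 < ereal x \<longrightarrow> ereal x < 1 \<longrightarrow> 0 \<le> x powr (s - 1) * (- ln x)"
    by (intro AE_I2 impI mult_nonneg_nonneg) (auto simp: zero_ereal_def one_ereal_def)
  have "set_integrable lborel (einterval 0 1) (\<lambda>t. t powr (s - 1) * (- ln t))"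
       "(LBINT t=0..1. t powr (s - 1) * (- ln t)) = 1 / s\<^sup>2 - 0"
    using interval_integral_FTC_nonneg[OF _ D C nn lim0 lim1] by (auto simp: zero_ereal_def)
  thus "set_integrable lborel {0<..<1} (\<lambda>t. t powr (s - 1) * (- ln t))"
    and "(LINT t:{0<..<1}|lborel. t powr (s - 1) * (- ln t)) = 1 / s\<^sup>2"
    by (simp_all add: zero_ereal_def one_ereal_def interval_integral_Ioo)
qed

lemma set_integrable_open_unit_bound:
  fixes f :: "real \<Rightarrow> 'a :: {banach, second_countable_topology}" and g :: "real \<Rightarrow> real"
  assumes g: "set_integrable lborel {0<..<1} g" and f: "continuous_on {0<..<1} f"
    and le: "\<And>t. 0 < t \<Longrightarrow> t < 1 \<Longrightarrow> norm (f t) \<le> g t"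
  shows "set_integrable lborel {0<..<1} f"
proof (rule set_integrable_bound[OF g])
  show "set_borel_measurable lborel {0<..<1} f"
    unfolding set_borel_measurable_def
    using borel_measurable_continuous_on_indicator[OF _ f] by simp
  show "AE t in lborel. t \<in> {0<..<1} \<longrightarrow> norm (f t) \<le> norm (g t)"
    using le by (intro AE_I2 impI) (smt (verit) greaterThanLessThan_iff real_norm_def)
qed

lemma continuous_on_ln_Gamma:
  "continuous_on {0<..} (\<lambda>t::real. ln (Gamma t))"
  by (intro continuous_intros)
     (auto elim!: nonpos_Ints_cases dest: Gamma_real_pos simp: Gamma_eq_zero_iff)

lemma power_neg_ln_integral:
  "set_integrable lborel {0<..<1} (\<lambda>t::real. t ^ m * (- ln t))"
  "(LINT t:{0<..<1}|lborel. t ^ m * (- ln t)) = 1 / (real m + 1)\<^sup>2"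
proof -
  have eq: "t powr (real (Suc m) - 1) = t ^ m" if "t > 0" for t :: real
    using that by (simp add: powr_realpow)
  have "set_integrable lborel {0<..<1} (\<lambda>t::real. t ^ m * (- ln t)) \<longleftrightarrow>
        set_integrable lborel {0<..<1} (\<lambda>t::real. t powr (real (Suc m) - 1) * (- ln t))"
    by (intro set_integrable_cong) (auto simp: eq simp del: of_nat_Suc)
  thus "set_integrable lborel {0<..<1} (\<lambda>t::real. t ^ m * (- ln t))"
    using powr_neg_ln_integral(1)[of "real (Suc m)"] by simp
  have "(LINT t:{0<..<1}|lborel. t ^ m * (- ln t)) =
        (LINT t:{0<..<1}|lborel. t powr (real (Suc m) - 1) * (- ln t))"
    by (intro set_lebesgue_integral_cong) (auto simp: eq simp del: of_nat_Suc)
  thus "(LINT t:{0<..<1}|lborel. t ^ m * (- ln t)) = 1 / (real m + 1)\<^sup>2"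
    using powr_neg_ln_integral(2)[of "real (Suc m)"] by (simp add: add_ac)
qed

lemma powr_ln_Gamma_integrable:
  fixes \<alpha> :: complex
  assumes "Re \<alpha> > 0"
  shows "set_integrable lborel {0<..<1} (\<lambda>t. of_real t powr (\<alpha> - 1) * of_real (ln (Gamma t)))"
proof (rule set_integrable_open_unit_bound[OF powr_neg_ln_integral(1)[OF assms]])
  show "continuous_on {0<..<1} (\<lambda>t. complex_of_real t powr (\<alpha> - 1) * of_real (ln (Gamma t)))"
    by (intro continuous_intros continuous_on_subset[OF continuous_on_ln_Gamma]) auto
  show "norm (complex_of_real t powr (\<alpha> - 1) * of_real (ln (Gamma t))) \<le> t powr (Re \<alpha> - 1) * (- ln t)"
    if "0 < t" "t < 1" for t
  proof -
    have "t powr (Re \<alpha> - 1) * ln (Gamma t) \<le> t powr (Re \<alpha> - 1) * (- ln t)"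
      using that ln_Gamma_bounds_unit_interval(2)[of t] by (intro mult_left_mono) auto
    thus ?thesis using that ln_Gamma_bounds_unit_interval(1)[of t]
      by (simp add: norm_mult norm_powr_real_powr)
  qed
qed

lemma powr_integral_unit_interval:
  fixes \<alpha> :: complex
  assumes "Re \<alpha> > 0"
  shows "set_integrable lborel {0<..<1} (\<lambda>t. complex_of_real t powr (\<alpha> - 1))"
    and "(LINT t:{0<..<1}|lborel. complex_of_real t powr (\<alpha> - 1)) = 1 / \<alpha>"
proof -
  define \<sigma> where "\<sigma> = Re \<alpha>"
  have \<sigma>: "\<sigma> > 0" using assms by (simp add: \<sigma>_def)
  have \<alpha>: "\<alpha> \<noteq> 0" using assms by auto
  let ?F = "\<lambda>t. t powr \<sigma> / \<sigma>" and ?G = "\<lambda>t. complex_of_real t powr \<alpha> / \<alpha>"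
  have lim0: "((?F \<circ> real_of_ereal) \<longlongrightarrow> 0) (at_right 0)"
  proof -
    have "(?F \<longlongrightarrow> 0) (at_right 0)" using \<sigma> by real_asymp
    thus ?thesis by (auto simp: zero_ereal_def ereal_tendsto_simps)
  qed
  have lim1: "((?F \<circ> real_of_ereal) \<longlongrightarrow> 1 / \<sigma>) (at_left 1)"
  proof -
    have "(?F \<longlongrightarrow> ?F 1) (at_left 1)" using \<sigma> by (intro tendsto_intros) auto
    thus ?thesis by (auto simp: one_ereal_def ereal_tendsto_simps)
  qed
  have "set_integrable lborel (einterval 0 1) (\<lambda>t. t powr (\<sigma> - 1))"
  proof (rule interval_integral_FTC_nonneg(1)[OF _ _ _ _ lim0 lim1])
    show "(?F has_real_derivative t powr (\<sigma> - 1)) (at t)" if "0 < ereal t" for t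
      using that \<sigma> by (auto intro!: derivative_eq_intros)
    show "isCont (\<lambda>t. t powr (\<sigma> - 1)) t" if "0 < ereal t" for t
      using that by (intro continuous_intros) auto
  qed auto
  hence "set_integrable lborel {0<..<1} (\<lambda>t. t powr (\<sigma> - 1))"
    by (simp add: zero_ereal_def one_ereal_def)
  thus int: "set_integrable lborel {0<..<1} (\<lambda>t. complex_of_real t powr (\<alpha> - 1))"
  proof (rule set_integrable_open_unit_bound)
    show "continuous_on {0<..<1} (\<lambda>t. complex_of_real t powr (\<alpha> - 1))"
      by (intro continuous_intros) auto
    show "norm (complex_of_real t powr (\<alpha> - 1)) \<le> t powr (\<sigma> - 1)" if "0 < t" "t < 1" for t
      using that by (simp add: norm_powr_real_powr \<sigma>_def)
  qed
  have lim0': "((?G \<circ> real_of_ereal) \<longlongrightarrow> 0) (at_right 0)"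
  proof -
    have "((\<lambda>t. t powr \<sigma> / norm \<alpha>) \<longlongrightarrow> 0) (at_right 0)"
      using \<sigma> \<alpha> by real_asymp
    moreover have "\<forall>\<^sub>F t in at_right 0. t powr \<sigma> / norm \<alpha> = norm (?G t)"
      using eventually_at_right_less[of "0 :: real"]
      by eventually_elim (simp add: norm_divide norm_powr_real_powr \<sigma>_def)
    ultimately have "((\<lambda>t. norm (?G t)) \<longlongrightarrow> 0) (at_right 0)"
      by (rule Lim_transform_eventually)
    hence "(?G \<longlongrightarrow> 0) (at_right 0)" by (rule tendsto_norm_zero_cancel)
    thus ?thesis by (auto simp: zero_ereal_def ereal_tendsto_simps)
  qed
  have lim1': "((?G \<circ> real_of_ereal) \<longlongrightarrow> 1 / \<alpha>) (at_left 1)"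
  proof -
    have "(?G \<longlongrightarrow> ?G 1) (at_left 1)" using \<alpha> by (intro tendsto_intros) auto
    thus ?thesis by (auto simp: one_ereal_def ereal_tendsto_simps)
  qed
  have "(LBINT t=0..1. complex_of_real t powr (\<alpha> - 1)) = 1 / \<alpha> - 0"
  proof (rule interval_integral_FTC_integrable[OF _ _ _ _ lim0' lim1'])
    show "(?G has_vector_derivative complex_of_real t powr (\<alpha> - 1)) (at t)"
      if "0 < ereal t" "ereal t < 1" for t
    proof (rule has_vector_derivative_real_field)
      have "complex_of_real t \<notin> \<real>\<^sub>\<le>\<^sub>0" using that by simp
      thus "((\<lambda>z. z powr \<alpha> / \<alpha>) has_field_derivative complex_of_real t powr (\<alpha> - 1)) (at (of_real t))"
        using \<alpha> by (auto intro!: derivative_eq_intros)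
    qed
    show "isCont (\<lambda>t. complex_of_real t powr (\<alpha> - 1)) t" if "0 < ereal t" "ereal t < 1" for t
      using that by (intro continuous_intros) auto
    show "set_integrable lborel (einterval 0 1) (\<lambda>t. complex_of_real t powr (\<alpha> - 1))"
      using int by (simp add: zero_ereal_def one_ereal_def)
  qed auto
  thus "(LINT t:{0<..<1}|lborel. complex_of_real t powr (\<alpha> - 1)) = 1 / \<alpha>"
    by (simp add: zero_ereal_def one_ereal_def interval_integral_Ioo)
qed

text \<open>
  These numbers link the two sides: expanding the kernel $(1-t)^{\alpha-1}$ in powers of $t$ turns the
  fractional integral into a series in them, and each of them is a combination of Glaisher constants.
\<close>

definition ln_Gamma_moment :: "nat \<Rightarrow> real" where
  "ln_Gamma_moment m = (LINT t:{0<..<1}|lborel. t ^ m * ln (Gamma t))"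

lemma set_integrable_power_ln_Gamma:
  "set_integrable lborel {0<..<1} (\<lambda>t::real. t ^ m * ln (Gamma t))"
proof (rule set_integrable_open_unit_bound[OF power_neg_ln_integral(1)[of m]])
  show "continuous_on {0<..<1} (\<lambda>t. t ^ m * ln (Gamma t) :: real)"
    by (intro continuous_intros continuous_on_subset[OF continuous_on_ln_Gamma]) auto
  show "norm (t ^ m * ln (Gamma t)) \<le> t ^ m * (- ln t)" if "0 < t" "t < 1" for t
  proof -
    have "t ^ m * ln (Gamma t) \<le> t ^ m * (- ln t)"
      using that ln_Gamma_bounds_unit_interval(2)[of t] by (intro mult_left_mono) auto
    thus ?thesis using that ln_Gamma_bounds_unit_interval(1)[of t] by (simp add: abs_mult)
  qed
qed

lemma ln_Gamma_moment_bounds: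
  "0 \<le> ln_Gamma_moment m" "ln_Gamma_moment m \<le> 1 / (real m + 1)\<^sup>2"
proof -
  show "0 \<le> ln_Gamma_moment m"
    unfolding ln_Gamma_moment_def set_lebesgue_integral_def using ln_Gamma_bounds_unit_interval(1)
    by (intro Bochner_Integration.integral_nonneg) (auto simp: indicator_def)
  have "ln_Gamma_moment m \<le> (LINT t:{0<..<1}|lborel. t ^ m * (- ln t))"
    unfolding ln_Gamma_moment_def using ln_Gamma_bounds_unit_interval(2)
    by (intro set_integral_mono set_integrable_power_ln_Gamma power_neg_ln_integral(1) mult_left_mono)
       auto
  thus "ln_Gamma_moment m \<le> 1 / (real m + 1)\<^sup>2"
    by (simp only: power_neg_ln_integral(2))
qed

section \<open>The binomial expansion of the kernel\<close>

text \<open>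
  Consecutive coefficients have the ratio $(\beta-k)/(k+1)$, and $|\beta - k| \le k + 1$ as soon as
  $|\beta|^2 \le 2k(1 + \Re\beta)$. From some index on the moduli therefore do not increase.
\<close>

lemma gbinomial_bounded:
  fixes \<beta> :: complex
  assumes "Re \<beta> > -1"
  obtains K where "\<And>n. norm (\<beta> gchoose n) \<le> K"
proof -
  obtain k0 :: nat where k0: "real k0 > (norm \<beta>)\<^sup>2 / (2 * (1 + Re \<beta>))"
    using reals_Archimedean2 by blast
  have step: "norm (\<beta> gchoose Suc k) \<le> norm (\<beta> gchoose k)" if "k \<ge> k0" for k
  proof -
    have "(norm \<beta>)\<^sup>2 < real k * (2 * (1 + Re \<beta>))"
      using k0 that assms by (subst (asm) pos_divide_less_eq) (auto elim!: order_less_le_trans intro!: mult_right_mono)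
    hence "(norm (\<beta> - of_nat k))\<^sup>2 \<le> (real (Suc k))\<^sup>2"
      unfolding cmod_power2 by (simp add: power2_eq_square algebra_simps)
    hence le: "norm (\<beta> - of_nat k) \<le> real (Suc k)"
      by (rule power2_le_imp_le) simp
    have "of_nat (Suc k) * (\<beta> gchoose Suc k) = (\<beta> - of_nat k) * (\<beta> gchoose k)"
      using gbinomial_mult_1[of \<beta> k] by (simp add: algebra_simps)
    hence "norm (of_nat (Suc k) * (\<beta> gchoose Suc k)) = norm ((\<beta> - of_nat k) * (\<beta> gchoose k))"
      by (rule arg_cong)
    hence "real (Suc k) * norm (\<beta> gchoose Suc k) = norm (\<beta> - of_nat k) * norm (\<beta> gchoose k)"
      by (simp only: norm_mult norm_of_nat)
    also have "\<dots> \<le> real (Suc k) * norm (\<beta> gchoose k)"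
      by (intro mult_right_mono le) auto
    finally show ?thesis by (subst (asm) mult_le_cancel_left_pos) auto
  qed
  have tail: "norm (\<beta> gchoose n) \<le> norm (\<beta> gchoose k0)" if "n \<ge> k0" for n
    using that by (induction n rule: dec_induct) (auto intro: order_trans step)
  have "norm (\<beta> gchoose n) \<le> (\<Sum>i\<le>k0. norm (\<beta> gchoose i))" for n
  proof (cases "n \<le> k0")
    case True
    thus ?thesis by (intro member_le_sum) auto
  next
    case False
    hence "norm (\<beta> gchoose n) \<le> norm (\<beta> gchoose k0)" by (intro tail) auto
    also have "\<dots> \<le> (\<Sum>i\<le>k0. norm (\<beta> gchoose i))"
      by (intro member_le_sum) auto
    finally show ?thesis .
  qed
  thus ?thesis by (rule that)
qed

text \<open>
  Termwise integration of the binomial series is justified by absolute convergence: the coefficients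
  are bounded, and the moments of the nonnegative function $\log\Gamma$ are at most $1/(m+1)^2$.
\<close>

lemma one_minus_powr_ln_Gamma_series:
  fixes \<alpha> :: complex
  assumes "Re \<alpha> > 0"
  shows "set_integrable lborel {0<..<1} (\<lambda>t. of_real (1 - t) powr (\<alpha> - 1) * of_real (ln (Gamma t)))"
      (is "set_integrable _ _ ?f")
    and "(\<lambda>m. (-1) ^ m * ((\<alpha> - 1) gchoose m) * of_real (ln_Gamma_moment m)) sums
           (LINT t:{0<..<1}|lborel. of_real (1 - t) powr (\<alpha> - 1) * of_real (ln (Gamma t)))"
proof -
  define c where "c m = (-1) ^ m * ((\<alpha> - 1) gchoose m)" for m
  obtain K where K: "norm ((\<alpha> - 1) gchoose m) \<le> K" for m
    using gbinomial_bounded[of "\<alpha> - 1"] assms by auto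
  have normc: "norm (c m) \<le> K" for m
    using K by (simp add: c_def norm_mult norm_power)
  have K0: "K \<ge> 0" using normc[of 0] norm_ge_zero order_trans by blast
  define g where "g m t = indicator {0<..<1} t *\<^sub>R (t ^ m * ln (Gamma t))" for m and t :: real
  define f where "f m t = c m * of_real (g m t)" for m t
  have int_g: "integrable lborel (g m)" for m
    using set_integrable_power_ln_Gamma[of m] unfolding set_integrable_def g_def [abs_def] .
  have int: "integrable lborel (f m)" for m
    unfolding f_def by (intro integrable_mult_right integrable_of_real int_g)
  have g_nonneg: "g m t \<ge> 0" for m t
    using ln_Gamma_bounds_unit_interval(1)[of t] by (auto simp: g_def indicator_def)
  have int_g_eq: "integral\<^sup>L lborel (g m) = ln_Gamma_moment m" for m
    by (simp add: ln_Gamma_moment_def g_def [abs_def] set_lebesgue_integral_def)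
  have sum_pt: "summable (\<lambda>m. norm (f m t))" for t
  proof (cases "t \<in> {0<..<1}")
    case True
    have "summable (\<lambda>m. (K * ln (Gamma t)) * t ^ m)"
      using True by (intro summable_mult summable_geometric) auto
    moreover have "norm (norm (f m t)) \<le> (K * ln (Gamma t)) * t ^ m" for m
    proof -
      have "norm (f m t) = norm (c m) * g m t"
        using g_nonneg[of m t] by (simp add: f_def norm_mult)
      also have "\<dots> \<le> K * g m t"
        by (intro mult_right_mono normc g_nonneg)
      finally show ?thesis using True by (simp add: g_def mult_ac)
    qed
    ultimately show ?thesis by (rule summable_comparison_test'[where N = 0])
  qed (simp add: f_def g_def)
  have sum_int: "summable (\<lambda>m. \<integral>t. norm (f m t) \<partial>lborel)"
  proof (rule summable_comparison_test')
    have "summable (\<lambda>m. K * (1 / (real (Suc m))\<^sup>2))"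
      using inverse_power_summable[of 2, where 'a = real]
      by (intro summable_mult) (subst summable_Suc_iff, simp add: field_simps)
    thus "summable (\<lambda>m. K * (1 / (real m + 1)\<^sup>2))" by (simp add: add_ac)
    fix m :: nat assume "m \<ge> 0"
    have "(\<integral>t. norm (f m t) \<partial>lborel) = norm (c m) * ln_Gamma_moment m"
      using g_nonneg by (simp add: f_def norm_mult int_g_eq)
    also have "\<dots> \<le> K * (1 / (real m + 1)\<^sup>2)"
      using K0 by (intro mult_mono normc ln_Gamma_moment_bounds) auto
    finally show "norm (\<integral>t. norm (f m t) \<partial>lborel) \<le> K * (1 / (real m + 1)\<^sup>2)"
      using Bochner_Integration.integral_nonneg[of lborel "\<lambda>t. norm (f m t)"] by simp
  qed
  have suminf: "(\<Sum>m. f m t) = indicator {0<..<1} t *\<^sub>R ?f t" for t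
  proof (cases "t \<in> {0<..<1}")
    case True
    have "(\<lambda>m. ((\<alpha> - 1) gchoose m) * (- of_real t) ^ m) sums (1 + (- of_real t)) powr (\<alpha> - 1)"
      using True by (intro gen_binomial_complex) auto
    from sums_mult2[OF this, of "of_real (ln (Gamma t))"]
    have "(\<lambda>m. f m t) sums ?f t"
      using True by (simp add: f_def g_def c_def power_minus[of "of_real t"] mult_ac)
    thus ?thesis using True by (simp add: sums_iff)
  qed (simp add: f_def g_def)
  note thms = integrable_suminf[OF int _ sum_int] sums_integral[OF int _ sum_int]
  show "set_integrable lborel {0<..<1} ?f"
    using thms(1) sum_pt by (simp add: set_integrable_def suminf)
  have "(\<lambda>m. integral\<^sup>L lborel (f m)) sums (LINT t:{0<..<1}|lborel. ?f t)"
    using thms(2) sum_pt by (simp add: set_lebesgue_integral_def suminf)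
  moreover have "integral\<^sup>L lborel (f m) = c m * of_real (ln_Gamma_moment m)" for m
    unfolding f_def by (simp add: int_g_eq)
  ultimately show "(\<lambda>m. (-1) ^ m * ((\<alpha> - 1) gchoose m) * of_real (ln_Gamma_moment m)) sums
           (LINT t:{0<..<1}|lborel. ?f t)"
    by (simp add: c_def)
qed

section \<open>Bernoulli polynomials and power sums\<close>

definition bernoulli_gf :: "real fps" where
  "bernoulli_gf = fps_X / (fps_exp 1 - 1)"

lemma bernoulli_gf_mult: "bernoulli_gf * (fps_exp 1 - 1) = fps_X"
proof -
  let ?E = "fps_exp 1 - 1 :: real fps"
  have nz: "?E \<noteq> 0"
    by (auto simp: fps_eq_iff intro!: exI[of _ 1])
  have "subdegree ?E = 1"
    by (auto intro!: subdegreeI)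
  hence "?E dvd fps_X"
    by (simp only: fps_dvd_iff[OF nz fps_X_neq_zero] subdegree_fps_X order_refl)
  thus ?thesis unfolding bernoulli_gf_def by (rule dvd_div_mult_self)
qed

text \<open>
  The Bernoulli polynomial of degree $m$ divided by $m!$. With this normalisation the
  derivative merely lowers the index, and the difference equation is read off from
  $(e^X - 1) \cdot X/(e^X-1) \cdot e^{xX} = X e^{xX}$.
\<close>

definition bern_poly :: "nat \<Rightarrow> real \<Rightarrow> real" where
  "bern_poly m x = fps_nth (bernoulli_gf * fps_exp x) m"

lemma bern_poly_altdef:
  "bern_poly m x = (\<Sum>i\<le>m. fps_nth bernoulli_gf i * (x ^ (m - i) / fact (m - i)))"
  by (simp add: bern_poly_def fps_mult_nth atMost_atLeast0)

lemma bern_poly_at_0: "bern_poly m 0 = bernoulli_num m / fact m"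
  by (simp add: bern_poly_def bernoulli_num_def bernoulli_gf_def)

lemma bern_poly_shift:
  "bern_poly (Suc m) (x + 1) - bern_poly (Suc m) x = x ^ m / fact m"
proof -
  have "bern_poly (Suc m) (x + 1) - bern_poly (Suc m) x
          = fps_nth (bernoulli_gf * (fps_exp 1 - 1) * fps_exp x) (Suc m)"
    by (simp add: bern_poly_def fps_exp_add_mult algebra_simps)
  thus ?thesis by (simp add: bernoulli_gf_mult)
qed

lemma bern_poly_0 [simp]: "bern_poly 0 x = 1"
proof -
  have "bern_poly 0 x = bern_poly (Suc 0) 1 - bern_poly (Suc 0) 0"
    by (simp add: bern_poly_altdef)
  also have "\<dots> = 1" using bern_poly_shift[of 0 0] by simp
  finally show ?thesis .
qed

lemma bern_poly_at_1: "bern_poly m 1 = bernoulli_num m / fact m + of_bool (m = 1)"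
proof (cases m)
  case (Suc k)
  thus ?thesis using bern_poly_shift[of k 0] by (cases k) (simp_all add: bern_poly_at_0)
qed (use bern_poly_at_0[of 0] in simp)

lemma power_over_fact_has_derivative:
  "((\<lambda>x. x ^ Suc r / fact (Suc r)) has_real_derivative x ^ r / fact r) (at x)" for x :: real
  by (rule DERIV_cong[OF DERIV_cdivide[OF DERIV_pow]])
     (simp add: fact_Suc[where 'a = real] del: of_nat_Suc)

lemma bern_poly_has_derivative:
  "(bern_poly (Suc m) has_real_derivative bern_poly m x) (at x)"
proof -
  have 1: "bern_poly (Suc m) = (\<lambda>x. (\<Sum>i\<le>m. fps_nth bernoulli_gf i * (x ^ Suc (m - i) / fact (Suc (m - i))))
                      + fps_nth bernoulli_gf (Suc m))"
    by (rule ext) (simp add: bern_poly_altdef Suc_diff_le)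
  show ?thesis
    unfolding 1 bern_poly_altdef[of m]
    by (rule DERIV_cong[OF DERIV_add[OF DERIV_sum[OF DERIV_cmult[OF power_over_fact_has_derivative]] DERIV_const]])
       simp
qed

text \<open>
  Faulhaber: the difference equation of the Bernoulli polynomials inverts the forward difference on
  each monomial.
\<close>

lemma sum_poly_is_poly:
  fixes q :: "real poly"
  obtains s where "poly s 0 = 0" "\<And>N. (\<Sum>j<N. poly q (real j)) = poly s (real N)"
proof -
  define b where "b r = smult (fact r) (\<Sum>i\<le>Suc r. monom (fps_nth bernoulli_gf i / fact (Suc r - i)) (Suc r - i))" for r
  have b: "poly (b r) x = fact r * bern_poly (Suc r) x" for r x
    unfolding b_def bern_poly_altdef poly_smult poly_sum poly_monom by (simp add: mult_ac)
  define s0 where "s0 = (\<Sum>r\<le>degree q. smult (coeff q r) (b r))"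
  have s0: "poly s0 x = (\<Sum>r\<le>degree q. coeff q r * (fact r * bern_poly (Suc r) x))" for x
    unfolding s0_def poly_sum poly_smult b ..
  have step: "poly s0 (x + 1) - poly s0 x = poly q x" for x
  proof -
    have "poly s0 (x + 1) - poly s0 x
       = (\<Sum>r\<le>degree q. coeff q r * (fact r * (bern_poly (Suc r) (x + 1) - bern_poly (Suc r) x)))"
      unfolding s0 sum_subtractf [symmetric] by (intro sum.cong) (auto simp: algebra_simps)
    also have "\<dots> = poly q x"
      unfolding bern_poly_shift by (simp add: poly_altdef)
    finally show ?thesis .
  qed
  define s where "s = s0 - [:poly s0 0:]"
  have "(\<Sum>j<N. poly q (real j)) = poly s (real N)" for N
  proof (induction N)
    case (Suc N)
    thus ?case using step[of "real N"] by (simp add: s_def add_ac)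
  qed (simp add: s_def)
  moreover have "poly s 0 = 0" by (simp add: s_def)
  ultimately show ?thesis using that by blast
qed

section \<open>Euler--Maclaurin summation and the Glaisher constants\<close>

text \<open>
  Up to the factor $k!$, this is the derivative of order $k - r$ of $x^k \log x$ for
  $r \le k$, and an antiderivative for $r = k + 1$. The constants are chosen so that differentiation
  always lowers $r$ by one, which treats all these cases alike.
\<close>

definition log_monomial :: "nat \<Rightarrow> nat \<Rightarrow> real \<Rightarrow> real" where
  "log_monomial k r x = x ^ r / fact r * (ln x + (harm k - harm r))"

lemma log_monomial_has_derivative:
  assumes "x > 0"
  shows "(log_monomial k (Suc r) has_real_derivative log_monomial k r x) (at x)"
proof -
  have 1: "log_monomial k (Suc r) = (\<lambda>x. x ^ Suc r / fact (Suc r) * (ln x + (harm k - harm (Suc r))))"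
    by (rule ext) (simp add: log_monomial_def)
  have "(log_monomial k (Suc r) has_real_derivative
      x ^ r / fact r * (ln x + (harm k - harm (Suc r))) + 1 / x * (x ^ Suc r / fact (Suc r))) (at x)"
    unfolding 1 using assms by (intro DERIV_mult' [THEN DERIV_cong] power_over_fact_has_derivative derivative_eq_intros refl) auto
  also have "1 / x * (x ^ Suc r / fact (Suc r)) = x ^ r / fact r * inverse (real (Suc r))"
    using assms by (simp add: fact_Suc[where 'a = real] divide_inverse del: of_nat_Suc)
  also have "x ^ r / fact r * (ln x + (harm k - harm (Suc r))) + x ^ r / fact r * inverse (real (Suc r))
       = log_monomial k r x"
    by (simp add: log_monomial_def harm_Suc algebra_simps del: of_nat_Suc)
  finally show ?thesis .
qed

text \<open>
  The Euler--Maclaurin expression for $\sum_m m^k \log m / k!$. It contains the term with the Bernoulli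
  number of index $k + 2$: that term tends to $0$, but including it makes the remainder summable.
\<close>

definition log_EM_sum :: "nat \<Rightarrow> real \<Rightarrow> real" where
  "log_EM_sum k x = log_monomial k k x +
     (\<Sum>m\<le>k+1. bernoulli_num m / fact m * log_monomial k (k + 1 - m) x)
     + bernoulli_num (k + 2) / fact (k + 2) * (1 / x)"

text \<open>
  The Euler--Maclaurin formula on one unit interval. Pairing each reflected Bernoulli polynomial with
  the derivative of complementary order gives a function \<open>\<Phi>\<close> whose derivative telescopes
  to a single term of size $O(1/j^2)$, while \<open>\<Phi> 1 - \<Phi> 0\<close> is the difference in
  question because a Bernoulli polynomial takes equal values at $0$ and $1$ except in degree $1$.
\<close>

lemma log_EM_sum_step:
  obtains C where "\<And>j::nat. j > 0 \<Longrightarrow>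
    \<bar>log_EM_sum k (real j + 1) - log_EM_sum k (real j) - (real j + 1) ^ k / fact k * ln (real j + 1)\<bar> \<le> C / real j ^ 2"
proof -
  have "continuous_on {0..1} (bern_poly (k + 2))"
    using DERIV_isCont[OF bern_poly_has_derivative[of "Suc k"]]
    by (auto intro!: continuous_at_imp_continuous_on simp: numeral_2_eq_2)
  hence "bounded (bern_poly (k + 2) ` {0..1})"
    by (intro compact_imp_bounded compact_continuous_image) auto
  then obtain C where C: "\<forall>t\<in>{0..1}. \<bar>bern_poly (k + 2) t\<bar> \<le> C"
    by (auto simp: bounded_iff)
  have "\<bar>log_EM_sum k (real j + 1) - log_EM_sum k (real j) - (real j + 1) ^ k / fact k * ln (real j + 1)\<bar>
        \<le> C / real j ^ 2" if j: "j > 0" for j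
  proof -
    define \<Phi> where "\<Phi> t = (\<Sum>m\<le>k+1. bern_poly m (1 - t) * log_monomial k (k + 1 - m) (real j + t))
       + bern_poly (k + 2) (1 - t) * (1 / (real j + t))" for t
    \<comment> \<open>The sign from the reflection \<open>1 - t\<close> is what makes consecutive terms cancel.\<close>
    have \<gamma>: "((\<lambda>t. bern_poly (Suc m) (1 - t)) has_real_derivative - bern_poly m (1 - t)) (at t)" for m t
    proof -
      have "((\<lambda>t::real. 1 - t) has_real_derivative -1) (at t)"
        by (auto intro!: derivative_eq_intros)
      from DERIV_chain2[where f = "bern_poly (Suc m)", OF bern_poly_has_derivative this]
      show ?thesis by simp
    qed
    have L: "((\<lambda>t. log_monomial k (Suc r) (real j + t)) has_real_derivative log_monomial k r (real j + t)) (at t)"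
      if "t \<ge> 0" for r t
    proof -
      have "((\<lambda>t::real. real j + t) has_real_derivative 1) (at t)"
        by (auto intro!: derivative_eq_intros)
      from DERIV_chain2[where f = "log_monomial k (Suc r)", OF log_monomial_has_derivative this]
      show ?thesis using j that by simp
    qed
    \<comment> \<open>The derivative of order \<open>k + 1\<close> is no longer a logarithmic monomial.\<close>
    have L0: "((\<lambda>t. log_monomial k 0 (real j + t)) has_real_derivative 1 / (real j + t)) (at t)"
      if "t \<ge> 0" for t
      unfolding log_monomial_def using that j by (auto intro!: derivative_eq_intros)
    have part: "((\<lambda>t. \<Sum>m\<le>n. bern_poly m (1 - t) * log_monomial k (k + 1 - m) (real j + t)) has_real_derivative
            bern_poly n (1 - t) * (if n = k + 1 then 1 / (real j + t) else log_monomial k (k - n) (real j + t))) (at t)"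
      if "t \<ge> 0" "n \<le> k + 1" for t n
      using that(2)
    proof (induction n)
      case 0
      show ?case using L[OF that(1), of k] by simp
    next
      case (Suc n)
      let ?l = "\<lambda>t. log_monomial k (k + 1 - Suc n) (real j + t)"
      let ?l' = "if Suc n = k + 1 then 1 / (real j + t) else log_monomial k (k - Suc n) (real j + t)"
      have l: "(?l has_real_derivative ?l') (at t)"
      proof (cases "n = k")
        case False
        hence "k + 1 - Suc n = Suc (k - Suc n)" using Suc.prems by auto
        thus ?thesis using L[OF that(1), of "k - Suc n"] False by simp
      qed (use L0[OF that(1)] in simp)
      have "n \<noteq> k + 1" "k + 1 - Suc n = k - n" using Suc.prems by auto
      thus ?case
        using DERIV_add[OF Suc.IH DERIV_mult[OF \<gamma>[of n t] l]] Suc.prems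
        by (simp add: algebra_simps)
    qed
    have deriv: "(\<Phi> has_real_derivative - bern_poly (k + 2) (1 - t) / (real j + t)\<^sup>2) (at t)" if "t \<ge> 0" for t
    proof -
      have inv: "((\<lambda>t. 1 / (real j + t)) has_real_derivative - 1 / (real j + t)\<^sup>2) (at t)"
        using j that by (auto intro!: derivative_eq_intros simp: power2_eq_square)
      show ?thesis unfolding \<Phi>_def
        using DERIV_add[OF part[OF that order.refl] DERIV_mult[OF \<gamma>[of "k + 1" t] inv]]
        by (simp add: algebra_simps numeral_2_eq_2)
    qed
    have "\<exists>z. 0 < z \<and> z < 1 \<and> \<Phi> 1 - \<Phi> 0 = (1 - 0) * (- bern_poly (k + 2) (1 - z) / (real j + z)\<^sup>2)"
      by (rule MVT2[OF zero_less_one deriv])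
    then obtain z where z: "0 < z" "z < 1" "\<Phi> 1 - \<Phi> 0 = - bern_poly (k + 2) (1 - z) / (real j + z)\<^sup>2"
      by auto
    have "\<bar>\<Phi> 1 - \<Phi> 0\<bar> = \<bar>bern_poly (k + 2) (1 - z)\<bar> / (real j + z)\<^sup>2"
      by (simp add: z(3))
    also have "\<dots> \<le> C / (real j)\<^sup>2"
      using C z(1,2) j order_trans[OF abs_ge_zero C[rule_format, of "1 - z"]] by (intro frac_le power_mono) auto
    finally have bound: "\<bar>\<Phi> 1 - \<Phi> 0\<bar> \<le> C / (real j)\<^sup>2" .
    have \<Phi>1: "\<Phi> 1 = log_EM_sum k (real j + 1) - log_monomial k k (real j + 1)"
      by (simp add: \<Phi>_def log_EM_sum_def bern_poly_at_0)
    have \<Phi>0: "\<Phi> 0 = log_EM_sum k (real j)"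
    proof -
      \<comment> \<open>The Bernoulli polynomial of degree one jumps by one, which accounts for the separate summand of \<open>log_EM_sum\<close>.\<close>
      have "(\<Sum>m\<le>k+1. of_bool (m = 1) * log_monomial k (k + 1 - m) (real j)) = log_monomial k k (real j)"
        by (subst sum.remove[of _ 1]) (auto intro!: sum.neutral)
      thus ?thesis
        by (simp add: \<Phi>_def log_EM_sum_def bern_poly_at_1 algebra_simps sum.distrib del: sum.atMost_Suc sum_mult_of_bool_eq)
    qed
    have "\<Phi> 1 - \<Phi> 0 = log_EM_sum k (real j + 1) - log_EM_sum k (real j) - (real j + 1) ^ k / fact k * ln (real j + 1)"
      by (simp add: \<Phi>1 \<Phi>0 log_monomial_def)
    with bound show ?thesis by simp
  qed
  thus ?thesis by (rule that)
qed

lemma bernoulli_num_0 [simp]: "bernoulli_num 0 = 1"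
  using bern_poly_at_0[of 0] by simp

lemma bernoulli_num_1: "bernoulli_num (Suc 0) = - 1 / 2"
proof -
  have "bern_poly 2 1 = bern_poly 2 0"
    using bern_poly_at_1[of 2] bern_poly_at_0[of 2] by simp
  moreover have "bern_poly 2 1 - bern_poly 2 0 = fps_nth bernoulli_gf 0 / 2 + fps_nth bernoulli_gf 1"
    by (simp add: bern_poly_altdef numeral_2_eq_2)
  moreover have "fps_nth bernoulli_gf 0 = bernoulli_num 0" "fps_nth bernoulli_gf 1 = bernoulli_num 1"
    by (simp_all add: bernoulli_num_def bernoulli_gf_def)
  ultimately show ?thesis by simp
qed

lemma sum_inverse_eq_harm_diff:
  assumes "m \<le> k"
  shows "(\<Sum>l=1..m. 1 / (real k - real l + 1)) = harm k - harm (k - m)"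
  using assms
proof (induction m)
  case (Suc m)
  hence "k - m = Suc (k - Suc m)" by auto
  hence "harm (k - m) = harm (k - Suc m) + 1 / real (k - m)"
    by (simp add: harm_Suc divide_inverse)
  thus ?case using Suc by (simp add: of_nat_diff algebra_simps)
qed simp

text \<open>
  The Kronecker delta in \<^const>\<open>glaisher_p\<close> removes the constant
  part of the last Euler--Maclaurin term, and the vanishing term $1/n$ is absent from it; otherwise the
  two expressions agree, the Bernoulli numbers of index $0$ and $1$ producing the leading terms.
\<close>

lemma glaisher_p_eq_log_EM_sum:
  "glaisher_p n k = fact k * log_EM_sum k (real n)
      - fact k * bernoulli_num (k + 1) / fact (k + 1) * harm k
      - fact k * bernoulli_num (k + 2) / fact (k + 2) * (1 / real n)"
proof -
  define x where "x = real n"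
  define f where "f m = bernoulli_num m / fact m * log_monomial k (k + 1 - m) x" for m
  define c where "c = bernoulli_num (k + 1) / fact (k + 1) * harm k"
  have f0: "fact k * f 0 = x ^ (k + 1) / real (k + 1) * (ln x - 1 / real (k + 1))"
  proof -
    have "fact k * (x ^ (k + 1) / fact (k + 1)) = x ^ (k + 1) / real (k + 1)"
      by (simp add: fact_Suc[where 'a = real] del: of_nat_Suc)
    moreover have "fact k * f 0 = fact k * (x ^ (k + 1) / fact (k + 1)) * (ln x + (harm k - harm (k + 1)))"
      by (simp add: f_def log_monomial_def)
    ultimately show ?thesis by (simp add: harm_Suc divide_inverse)
  qed
  have f1: "fact k * (log_monomial k k x + f 1) = x ^ k * ln x / 2"
    by (simp add: f_def log_monomial_def bernoulli_num_1)
  have summand: "x ^ (k - m) * bernoulli_num (m + 1) / (fact (m + 1) * fact (k - m)) *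
       (ln x + (1 - of_bool (k = m)) * (\<Sum>l=1..m. 1 / (real k - real l + 1)))
       = f (Suc m) - of_bool (k = m) * c" if "m \<in> {1..k}" for m
  proof (cases "m = k")
    case True
    thus ?thesis by (simp add: f_def c_def log_monomial_def harm_expand(1) algebra_simps add_divide_distrib)
  next
    case False
    thus ?thesis using that sum_inverse_eq_harm_diff[of m k]
      by (simp add: f_def log_monomial_def mult_ac)
  qed
  have c: "(\<Sum>m=1..k. of_bool (k = m) * c) = c"
  proof (cases "k = 0")
    case False
    thus ?thesis by (subst sum.remove[of _ k]) (auto intro!: sum.neutral)
  qed (simp add: c_def harm_expand(1))
  have "(\<Sum>m\<le>k+1. f m) = f 0 + (f 1 + (\<Sum>m=1..k. f (Suc m)))"
    using sum.atMost_Suc_shift[of f k] sum.atLeast_Suc_atMost[of 0 k "\<lambda>m. f (Suc m)"]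
    by (simp add: atMost_atLeast0 del: sum.atMost_Suc sum.atLeast0_atMost_Suc)
  hence "fact k * log_EM_sum k x = fact k * f 0 + fact k * (log_monomial k k x + f 1)
      + fact k * (\<Sum>m=1..k. f (Suc m)) + fact k * bernoulli_num (k + 2) / fact (k + 2) * (1 / x)"
    unfolding log_EM_sum_def f_def [symmetric] by (simp add: algebra_simps del: fact_Suc)
  moreover have "glaisher_p n k = x ^ k * ln x / 2 + x ^ (k + 1) / real (k + 1) * (ln x - 1 / real (k + 1))
      + fact k * (\<Sum>m=1..k. f (Suc m) - of_bool (k = m) * c)"
    unfolding glaisher_p_def x_def [symmetric]
    by (intro arg_cong2[of _ _ _ _ "(+)"] arg_cong2[of _ _ _ _ "(*)"] refl sum.cong summand)
  ultimately show ?thesis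
    by (simp only: f0 f1 sum_subtractf c x_def [symmetric]) (simp add: c_def algebra_simps del: fact_Suc)
qed

text \<open>
  The increments of the sequence are $O(1/n^2)$ by the Euler--Maclaurin step, so the limit in the
  definition of \<^const>\<open>glaisher_D\<close> exists.
\<close>

lemma glaisher_D_limit:
  "(\<lambda>n. (\<Sum>m=1..n. real m ^ k * ln (real m)) - glaisher_p n k) \<longlonglongrightarrow> ln (glaisher_D k)"
proof -
  define a where "a n = (\<Sum>m=1..n. real m ^ k * ln (real m)) - fact k * log_EM_sum k (real n)" for n
  obtain C where C: "\<And>j::nat. j > 0 \<Longrightarrow>
    \<bar>log_EM_sum k (real j + 1) - log_EM_sum k (real j) - (real j + 1) ^ k / fact k * ln (real j + 1)\<bar> \<le> C / real j ^ 2"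
    using log_EM_sum_step[of k] by blast
  have "summable (\<lambda>n. a (Suc n) - a n)"
  proof (rule summable_comparison_test'[where N = 1])
    show "summable (\<lambda>n. fact k * (C * inverse (real n ^ 2)))"
      by (intro summable_mult inverse_power_summable) auto
    fix n :: nat assume n: "n \<ge> 1"
    have "a (Suc n) - a n = - (fact k * (log_EM_sum k (real n + 1) - log_EM_sum k (real n)
             - (real n + 1) ^ k / fact k * ln (real n + 1)))"
      by (simp add: a_def algebra_simps)
    hence "norm (a (Suc n) - a n) = fact k * \<bar>log_EM_sum k (real n + 1) - log_EM_sum k (real n)
             - (real n + 1) ^ k / fact k * ln (real n + 1)\<bar>"
      by (simp add: abs_mult)
    also have "\<dots> \<le> fact k * (C / real n ^ 2)"
      using n by (intro mult_left_mono C) auto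
    finally show "norm (a (Suc n) - a n) \<le> fact k * (C * inverse (real n ^ 2))"
      by (simp add: divide_inverse)
  qed
  hence "convergent (\<lambda>n. \<Sum>i<n. a (Suc i) - a i)"
    by (simp add: summable_iff_convergent)
  hence "convergent (\<lambda>n. a n - a 0)"
    by (simp only: sum_lessThan_telescope)
  hence "convergent a" by (simp add: convergent_diff_const_right_iff)
  then obtain l where l: "a \<longlonglongrightarrow> l" by (auto simp: convergent_def)
  have "(\<lambda>n. a n + fact k * bernoulli_num (k + 1) / fact (k + 1) * harm k
      + fact k * bernoulli_num (k + 2) / fact (k + 2) * (1 / real n)) \<longlonglongrightarrow>
      l + fact k * bernoulli_num (k + 1) / fact (k + 1) * harm k + fact k * bernoulli_num (k + 2) / fact (k + 2) * 0"
    by (intro tendsto_intros l lim_1_over_n)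
  also have "(\<lambda>n. a n + fact k * bernoulli_num (k + 1) / fact (k + 1) * harm k
      + fact k * bernoulli_num (k + 2) / fact (k + 2) * (1 / real n))
      = (\<lambda>n. (\<Sum>m=1..n. real m ^ k * ln (real m)) - glaisher_p n k)"
    by (rule ext) (simp add: a_def glaisher_p_eq_log_EM_sum)
  finally have "convergent (\<lambda>n. (\<Sum>m=1..n. real m ^ k * ln (real m)) - glaisher_p n k)"
    by (rule convergentI)
  thus ?thesis by (simp add: glaisher_D_def convergent_LIMSEQ_iff)
qed

text \<open>
  Beyond the shape of $p(n,k)$, what matters is that its part without logarithm vanishes at
  $0$; this is precisely the effect of the Kronecker delta.
\<close>

lemma glaisher_p_polynomials:
  obtains A C where "poly C 0 = 0" "\<And>n. glaisher_p n k = poly A (real n) * ln (real n) + poly C (real n)"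
proof -
  define c where "c m = fact k * bernoulli_num (m + 1) / (fact (m + 1) * fact (k - m))" for m
  define d where "d m = (1 - of_bool (k = m)) * (\<Sum>l=1..m. 1 / (real k - real l + 1))" for m
  define q where "q = 1 / real (k + 1)"
  define A where "A = monom (1 / 2) k + monom q (k + 1) + (\<Sum>m=1..k. monom (c m) (k - m))"
  define C where "C = monom (- (q * q)) (k + 1) + (\<Sum>m=1..k. monom (c m * d m) (k - m))"
  have "poly C 0 = 0"
  proof -
    have "c m * d m * 0 ^ (k - m) = 0" if "m \<in> {1..k}" for m
      using that by (cases "m = k") (auto simp: d_def)
    hence "(\<Sum>m=1..k. c m * d m * 0 ^ (k - m)) = 0" by (intro sum.neutral ballI)
    thus ?thesis by (simp add: C_def poly_sum poly_monom)
  qed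
  moreover have "glaisher_p n k = poly A (real n) * ln (real n) + poly C (real n)" for n
  proof -
    have "fact k * (\<Sum>m=1..k. real n ^ (k - m) * bernoulli_num (m + 1) / (fact (m + 1) * fact (k - m)) *
       (ln (real n) + d m)) = (\<Sum>m=1..k. c m * real n ^ (k - m)) * ln (real n)
         + (\<Sum>m=1..k. c m * d m * real n ^ (k - m))"
      unfolding sum_distrib_left sum_distrib_right sum.distrib [symmetric]
      by (intro sum.cong) (simp_all add: c_def algebra_simps add_divide_distrib)
    moreover have "real n ^ (k + 1) / real (k + 1) * (ln (real n) - 1 / real (k + 1))
        = q * real n ^ (k + 1) * (ln (real n) - q)"
      by (simp add: q_def)
    ultimately show ?thesis unfolding glaisher_p_def d_def [symmetric]
      by (simp add: A_def C_def poly_sum poly_monom algebra_simps)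
  qed
  ultimately show ?thesis by (rule that)
qed

text \<open>
  The functions $1, \log n, n, n \log n, n^2, \dots$ have pairwise different orders of growth. In the
  induction, dividing by $n$ strips the two lowest coefficients and leaves an expression tending
  to $0$.
\<close>

lemma poly_ln_convergent_imp_const:
  fixes P Q :: "real poly"
  assumes "(\<lambda>n. poly P (real n) * ln (real n) + poly Q (real n)) \<longlonglongrightarrow> c"
  shows "P = 0 \<and> Q = [:c:]"
  using assms
proof (induction P Q arbitrary: c rule: poly_induct2)
  case 0
  thus ?case by (simp add: LIMSEQ_const_iff)
next
  case (pCons a P b Q)
  let ?f = "\<lambda>n. poly P (real n) * ln (real n) + poly Q (real n)"
  have "(\<lambda>n. (poly (pCons a P) (real n) * ln (real n) + poly (pCons b Q) (real n)) * (1 / real n)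
           - (a * (ln (real n) / real n) + b * (1 / real n))) \<longlonglongrightarrow> c * 0 - (a * 0 + b * 0)"
    by (intro tendsto_intros pCons.prems lim_1_over_n)
  moreover have "\<forall>\<^sub>F n in sequentially. (poly (pCons a P) (real n) * ln (real n) + poly (pCons b Q) (real n)) * (1 / real n)
           - (a * (ln (real n) / real n) + b * (1 / real n)) = ?f n"
    using eventually_gt_at_top[of 0] by eventually_elim (simp add: field_simps)
  ultimately have "?f \<longlonglongrightarrow> 0"
    using Lim_transform_eventually by fastforce
  from pCons.IH[OF this] have PQ: "P = 0" "Q = 0" by auto
  have lim: "(\<lambda>n. a * ln (real n) + b) \<longlonglongrightarrow> c"
    using pCons.prems by (simp add: PQ mult.commute)
  have "(\<lambda>n. (a * ln (real n) + b) * (1 / ln (real n)) - b * (1 / ln (real n))) \<longlonglongrightarrow> c * 0 - b * 0"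
    by (intro tendsto_intros lim) real_asymp+
  moreover have "\<forall>\<^sub>F n in sequentially. (a * ln (real n) + b) * (1 / ln (real n)) - b * (1 / ln (real n)) = a"
    using eventually_gt_at_top[of 1] by eventually_elim (simp add: field_simps)
  ultimately have "(\<lambda>n::nat. a) \<longlonglongrightarrow> 0"
    using Lim_transform_eventually by fastforce
  hence a: "a = 0" by (simp add: LIMSEQ_const_iff)
  with lim have "b = c" by (simp add: LIMSEQ_const_iff)
  with a PQ show ?case by simp
qed

section \<open>The moments of the logarithmic Gamma function\<close>

lemma set_integral_FTC_unit_interval:
  fixes F f :: "real \<Rightarrow> real"
  assumes "\<And>t. 0 \<le> t \<Longrightarrow> t \<le> 1 \<Longrightarrow> (F has_real_derivative f t) (at t)"
    and "\<And>t. 0 \<le> t \<Longrightarrow> t \<le> 1 \<Longrightarrow> isCont f t"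
  shows "set_integrable lborel {0<..<1} f" "(LINT t:{0<..<1}|lborel. f t) = F 1 - F 0"
proof -
  have b: "has_bochner_integral lborel (\<lambda>t. f t * indicator {0..1} t) (F 1 - F 0)"
    by (rule has_bochner_integral_FTC_Icc_real) (use assms in auto)
  hence "set_integrable lborel {0..1} f"
    unfolding set_integrable_def by (simp add: has_bochner_integral_iff mult.commute)
  thus "set_integrable lborel {0<..<1} f"
    by (rule set_integrable_subset) auto
  have "(LINT t:{0..1}|lborel. f t) = F 1 - F 0"
    using b unfolding set_lebesgue_integral_def by (simp add: has_bochner_integral_iff mult.commute)
  thus "(LINT t:{0<..<1}|lborel. f t) = F 1 - F 0"
    by (simp only: set_integral_Icc_eq_open)
qed

text \<open>
  Integration by parts with the antiderivative $t^n - (-j)^n$ of $n t^{n-1}$: this choice of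
  the constant cancels the pole of $1/(j+t)$ and leaves a polynomial.
\<close>

lemma power_ln_shift_integral:
  fixes j n :: nat
  assumes n: "n > 0"
  shows "set_integrable lborel {0<..<1} (\<lambda>t. real n * t ^ (n - 1) * ln (real j + t))" (is ?int)
    and "(LINT t:{0<..<1}|lborel. real n * t ^ (n - 1) * ln (real j + t)) =
           (1 - (- real j) ^ n) * ln (real j + 1) + (- real j) ^ n * ln (real j)
           - (\<Sum>i<n. (- real j) ^ (n - Suc i) / real (Suc i))" (is ?eq)
proof -
  have "?int \<and> ?eq"
  proof (cases "j = 0")
    case True
    have eq: "real n * t ^ (n - 1) * ln (real j + t) = - real n * (t ^ (n - 1) * (- ln t))" for t
      using True by simp
    \<comment> \<open>For \<open>j = 0\<close> only the summand with \<open>0 ^ 0 = 1\<close> survives, and \<open>ln 0 = 0\<close> occurs with factor \<open>0\<close>.\<close>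
    have "(\<Sum>i<n. 0 ^ (n - Suc i) / real (Suc i)) = 1 / real n"
    proof -
      have "(\<Sum>i<n. 0 ^ (n - Suc i) / real (Suc i)) = (\<Sum>i\<in>{n - 1}. 0 ^ (n - Suc i) / real (Suc i))"
        using n by (intro sum.mono_neutral_right) auto
      thus ?thesis using n by simp
    qed
    moreover have "set_integrable lborel {0<..<1} (\<lambda>t. - real n * (t ^ (n - 1) * (- ln t)))"
      by (intro set_integrable_mult_right power_neg_ln_integral(1))
    moreover have "(LINT t:{0<..<1}|lborel. - real n * (t ^ (n - 1) * (- ln t))) = - 1 / real n"
      using n by (simp only: set_integral_mult_right power_neg_ln_integral(2))
        (simp add: power2_eq_square of_nat_diff)
    ultimately show ?thesis
      unfolding eq using True n by simp
  next
    case False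
    let ?f = "\<lambda>t. real n * t ^ (n - 1) * ln (real j + t)"
    let ?F = "\<lambda>t. (t ^ n - (- real j) ^ n) * ln (real j + t)
                - (\<Sum>i<n. (- real j) ^ (n - Suc i) * (t ^ Suc i / real (Suc i)))"
    have D: "(?F has_real_derivative ?f t) (at t)" if "0 \<le> t" "t \<le> 1" for t
    proof -
      have pos: "real j + t > 0" using False that by simp
      have *: "((\<lambda>t. t ^ Suc i / real (Suc i)) has_real_derivative t ^ i) (at t)" for i
        by (rule DERIV_cong[OF DERIV_cdivide[OF DERIV_pow]]) (simp del: of_nat_Suc)
      have l: "((\<lambda>t. ln (real j + t)) has_real_derivative 1 / (real j + t)) (at t)"
        using pos by (auto intro!: derivative_eq_intros)
      have p: "((\<lambda>t. t ^ n - (- real j) ^ n) has_real_derivative real n * t ^ (n - 1)) (at t)"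
        by (auto intro!: derivative_eq_intros)
      have "t ^ n - (- real j) ^ n = (real j + t) * (\<Sum>i<n. (- real j) ^ (n - Suc i) * t ^ i)"
        using power_diff_sumr2[of t n "- real j"] by (simp add: add.commute)
      hence "1 / (real j + t) * (t ^ n - (- real j) ^ n) = (\<Sum>i<n. (- real j) ^ (n - Suc i) * t ^ i)"
        using pos by simp
      thus ?thesis
        by (intro DERIV_cong[OF DERIV_diff[OF DERIV_mult[OF p l] DERIV_sum[OF DERIV_cmult[OF *]]]])
           simp
    qed
    have C: "isCont ?f t" if "0 \<le> t" "t \<le> 1" for t
      using that False by (intro continuous_intros) auto
    show ?thesis
      using set_integral_FTC_unit_interval[of ?F ?f, OF D C] n
      by (simp add: zero_power algebra_simps)
  qed
  thus ?int ?eq by auto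
qed

lemma power_weight_affine_integral:
  fixes a b :: real
  assumes "n > 0"
  shows "set_integrable lborel {0<..<1} (\<lambda>t. real n * t ^ (n - 1) * (a + t * b))"
    and "(LINT t:{0<..<1}|lborel. real n * t ^ (n - 1) * (a + t * b)) = a + b - b / real (n + 1)"
proof -
  let ?F = "\<lambda>t. a * t ^ n + b * real n / real (n + 1) * t ^ (n + 1)"
  let ?f = "\<lambda>t. real n * t ^ (n - 1) * (a + t * b)"
  have D: "(?F has_real_derivative ?f t) (at t)" for t
  proof -
    have "t ^ n = t * t ^ (n - 1)"
      using assms by (cases n) auto
    moreover have "b * real n / real (n + 1) * (real (n + 1) * t ^ n) = b * real n * t ^ n"
      by simp
    moreover have "(?F has_real_derivative a * (real n * t ^ (n - 1))
        + b * real n / real (n + 1) * (real (n + 1) * t ^ n)) (at t)"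
      using DERIV_pow[of "n + 1" t UNIV] DERIV_pow[of n t UNIV]
      by (intro DERIV_add DERIV_cmult) auto
    ultimately show ?thesis by (simp add: algebra_simps)
  qed
  have C: "isCont ?f t" for t by (intro continuous_intros)
  show "set_integrable lborel {0<..<1} ?f"
    using set_integral_FTC_unit_interval(1)[of ?F ?f, OF D C] by simp
  have "b * real n / real (n + 1) = b - b / real (n + 1)"
    by (simp add: field_simps)
  thus "(LINT t:{0<..<1}|lborel. ?f t) = a + b - b / real (n + 1)"
    using set_integral_FTC_unit_interval(2)[of ?F ?f, OF D C] assms by simp
qed

text \<open>
  Summation by parts: at a point $m \ge 1$ the factor of $\log m$ is
  $1 - (1-m)^n + (-m)^n$, and expanding $(1-m)^n$ by the binomial theorem cancels the power $m^n$
  everywhere but at $m = N$.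
\<close>

lemma sum_power_ln_shift_integrals:
  fixes n N :: nat
  assumes n: "n > 0"
  shows "(\<Sum>j<N. (1 - (- real j) ^ n) * ln (real j + 1) + (- real j) ^ n * ln (real j))
           = (\<Sum>m=1..N. ln (real m))
             - (\<Sum>k<n. (-1) ^ k * real (n choose k) * (\<Sum>m=1..N. real m ^ k * ln (real m)))
             - (- real N) ^ n * ln (real N)"
proof (induction N)
  case 0
  show ?case using n by simp
next
  case (Suc N)
  let ?x = "real N + 1"
  have "(- real N) ^ n = (- ?x + 1) ^ n" by simp
  also have "\<dots> = (\<Sum>k\<le>n. of_nat (n choose k) * (- ?x) ^ k * 1 ^ (n - k))"
    by (rule binomial_ring)
  also have "\<dots> = (\<Sum>k<n. (-1) ^ k * real (n choose k) * ?x ^ k) + (- ?x) ^ n"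
    unfolding lessThan_Suc_atMost [symmetric] sum.lessThan_Suc
    by (intro arg_cong2[of _ _ _ _ "(+)"] sum.cong) (simp_all only: power_minus[of ?x], simp_all)
  finally have "(- real N) ^ n * ln ?x = (\<Sum>k<n. (-1) ^ k * real (n choose k) * (?x ^ k * ln ?x)) + (- ?x) ^ n * ln ?x"
    by (simp add: algebra_simps sum_distrib_left)
  thus ?case using Suc.IH
    by (simp add: algebra_simps sum.distrib)
qed

text \<open>
  Write $\log\Gamma(t) = \log\Gamma(N+t) - \sum_{j<N} \log(j+t)$ and integrate against $n t^{n-1}$. The first
  term is almost affine in $t$, and the second one has been integrated exactly.
\<close>

lemma ln_Gamma_moment_approx:
  fixes n N :: nat
  assumes n: "n > 0" and N: "N \<ge> 2"
  shows "\<bar>real n * ln_Gamma_moment (n - 1) -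
           ((\<Sum>k<n. (-1) ^ k * real (n choose k) * (\<Sum>m=1..N. real m ^ k * ln (real m)))
             + (- real N) ^ n * ln (real N) - ln (real N) / real (n + 1)
             + (\<Sum>j<N. \<Sum>i<n. (- real j) ^ (n - Suc i) / real (Suc i)))\<bar>
         \<le> ln (real N) - ln (real N - 1)"
proof -
  let ?I = "\<lambda>f. LINT t:{0<..<1}|lborel. real n * t ^ (n - 1) * f t"
  let ?int = "\<lambda>f. set_integrable lborel {0<..<1} (\<lambda>t. real n * t ^ (n - 1) * f t)"
  define G where "G t = ln (Gamma (real N + t))" for t
  define \<epsilon> where "\<epsilon> = ln (real N) - ln (real N - 1)"
  have intj: "?int (\<lambda>t. ln (real j + t))" for j
    by (rule power_ln_shift_integral(1)[OF n])
  have int0: "?int (\<lambda>t. ln (Gamma t))"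
    using set_integrable_mult_right[OF set_integrable_power_ln_Gamma[of "n - 1"], of "real n"]
    by (simp add: mult.assoc)
  have intS: "set_integrable lborel {0<..<1} (\<lambda>t. \<Sum>j<N. real n * t ^ (n - 1) * ln (real j + t))"
    using intj unfolding set_integrable_def scaleR_sum_right
    by (intro Bochner_Integration.integrable_sum)
  have sum_I: "(LINT t:{0<..<1}|lborel. \<Sum>j<N. real n * t ^ (n - 1) * ln (real j + t)) =
      (\<Sum>j<N. ?I (\<lambda>t. ln (real j + t)))"
    using intj unfolding set_lebesgue_integral_def set_integrable_def scaleR_sum_right
    by (intro Bochner_Integration.integral_sum)
  have split: "real n * t ^ (n - 1) * G t = real n * t ^ (n - 1) * ln (Gamma t)
      + (\<Sum>j<N. real n * t ^ (n - 1) * ln (real j + t))" if "t \<in> {0<..<1}" for t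
    unfolding sum_distrib_left [symmetric] distrib_left [symmetric]
    using that ln_Gamma_add_nat[of t N] by (simp add: G_def)
  have intG: "?int G"
  proof -
    have "?int G \<longleftrightarrow> set_integrable lborel {0<..<1} (\<lambda>t. real n * t ^ (n - 1) * ln (Gamma t)
        + (\<Sum>j<N. real n * t ^ (n - 1) * ln (real j + t)))"
      by (rule set_integrable_cong) (use split in auto)
    thus ?thesis using set_integral_add(1)[OF int0 intS] by simp
  qed
  have "?I G = (LINT t:{0<..<1}|lborel. real n * t ^ (n - 1) * ln (Gamma t)
        + (\<Sum>j<N. real n * t ^ (n - 1) * ln (real j + t)))"
    by (rule set_lebesgue_integral_cong) (use split in auto)
  also have "\<dots> = ?I (\<lambda>t. ln (Gamma t)) + (\<Sum>j<N. ?I (\<lambda>t. ln (real j + t)))"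
    by (simp only: set_integral_add(2)[OF int0 intS] sum_I)
  also have "?I (\<lambda>t. ln (Gamma t)) = real n * ln_Gamma_moment (n - 1)"
    unfolding ln_Gamma_moment_def by (simp add: mult.assoc)
  finally have moment: "real n * ln_Gamma_moment (n - 1) = ?I G - (\<Sum>j<N. ?I (\<lambda>t. ln (real j + t)))"
    by simp
  have near: "\<bar>G t - (ln (fact (N - 1)) + t * ln (real N))\<bar> \<le> \<epsilon>" if "0 < t" "t < 1" for t
    using ln_Gamma_large_approx[of t N] that N by (simp add: G_def \<epsilon>_def)
  have "?I G \<le> ?I (\<lambda>t. (ln (fact (N - 1)) + \<epsilon>) + t * ln (real N))"
    by (intro set_integral_mono intG power_weight_affine_integral n mult_left_mono)
       (use near in \<open>force simp: abs_le_iff\<close>)+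
  moreover have "?I (\<lambda>t. (ln (fact (N - 1)) - \<epsilon>) + t * ln (real N)) \<le> ?I G"
    by (intro set_integral_mono intG power_weight_affine_integral n mult_left_mono)
       (use near in \<open>force simp: abs_le_iff\<close>)+
  ultimately have "\<bar>?I G - (ln (fact (N - 1)) + ln (real N) - ln (real N) / real (n + 1))\<bar> \<le> \<epsilon>"
    unfolding power_weight_affine_integral(2)[OF n] by linarith
  moreover have "ln (fact (N - 1)) + ln (real N) = (\<Sum>m=1..N. ln (real m))"
  proof -
    have "ln (fact (N - 1)) + ln (real N) = ln (fact N :: real)"
      using N by (simp add: fact_reduce[of N] ln_mult_pos)
    also have "\<dots> = (\<Sum>m=1..N. ln (real m))"
      by (induction N) (simp_all add: ln_mult_pos)
    finally show ?thesis .
  qed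
  moreover have "(\<Sum>j<N. ?I (\<lambda>t. ln (real j + t))) = 
      (\<Sum>m=1..N. ln (real m))
             - (\<Sum>k<n. (-1) ^ k * real (n choose k) * (\<Sum>m=1..N. real m ^ k * ln (real m)))
             - (- real N) ^ n * ln (real N)
             - (\<Sum>j<N. \<Sum>i<n. (- real j) ^ (n - Suc i) / real (Suc i))"
    unfolding power_ln_shift_integral(2)[OF n] sum_subtractf sum_power_ln_shift_integrals[OF n] ..
  ultimately show ?thesis
    unfolding moment \<epsilon>_def by (simp add: algebra_simps)
qed

text \<open>
  After each $\sum_{m \le N} m^k \log m$ is replaced by
  $\log D_k + p(N,k) + o(1)$, the approximation says that the difference of the two sides is the limit
  of an expression $P(N) \log N + Q(N)$ with polynomials $P$ and $Q$. Such a limit can exist only if $Q$ is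
  constant, and $Q(0) = 0$ because the polynomial parts of all $p(\cdot,k)$ and the power sums vanish at $0$.
\<close>

lemma ln_Gamma_moment_eq_glaisher:
  assumes n: "n > 0"
  shows "real n * ln_Gamma_moment (n - 1) = (\<Sum>k<n. (-1) ^ k * real (n choose k) * ln (glaisher_D k))"
proof -
  have "\<forall>k. \<exists>A C. poly C 0 = 0 \<and> (\<forall>N. glaisher_p N k = poly A (real N) * ln (real N) + poly C (real N))"
    using glaisher_p_polynomials by metis
  then obtain A C where C0: "\<And>k. poly (C k) 0 = 0"
    and p: "\<And>k N. glaisher_p N k = poly (A k) (real N) * ln (real N) + poly (C k) (real N)"
    by metis
  define b where "b k = (-1) ^ k * real (n choose k)" for k
  define L where "L k N = (\<Sum>m=1..N. real m ^ k * ln (real m))" for k N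
  define R where "R N = (\<Sum>j<N. \<Sum>i<n. (- real j) ^ (n - Suc i) / real (Suc i))" for N
  define q :: "real poly" where "q = (\<Sum>i<n. smult (1 / real (Suc i)) ([:0, -1:] ^ (n - Suc i)))"
  have "(\<Sum>j<N. poly q (real j)) = R N" for N
    by (simp add: q_def R_def poly_sum)
  with sum_poly_is_poly[of q] obtain s where s: "poly s 0 = 0" "\<And>N. R N = poly s (real N)"
    by metis
  define P where "P = (\<Sum>k<n. smult (b k) (A k)) + smult ((-1) ^ n) (monom 1 n) - [:1 / real (n + 1):]"
  define Q where "Q = (\<Sum>k<n. smult (b k) (C k)) + s"
  define E where "E N = real n * ln_Gamma_moment (n - 1) -
     ((\<Sum>k<n. b k * L k N) + (- real N) ^ n * ln (real N) - ln (real N) / real (n + 1) + R N)" for N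
  have PQ: "poly P (real N) * ln (real N) + poly Q (real N) =
        real n * ln_Gamma_moment (n - 1) - E N - (\<Sum>k<n. b k * (L k N - glaisher_p N k))" for N
    unfolding P_def Q_def E_def p
    by (simp add: poly_sum poly_monom s(2) power_minus[of "real N"] algebra_simps
          sum.distrib sum_subtractf sum_distrib_left)
  have "E \<longlonglongrightarrow> 0"
  proof (rule Lim_null_comparison)
    show "\<forall>\<^sub>F N in sequentially. norm (E N) \<le> ln (real N) - ln (real N - 1)"
      using eventually_ge_at_top[of 2]
      by eventually_elim (use ln_Gamma_moment_approx[OF n] in \<open>simp add: E_def b_def L_def R_def\<close>)
    show "(\<lambda>N. ln (real N) - ln (real N - 1)) \<longlonglongrightarrow> 0" by real_asymp
  qed
  moreover have "(\<lambda>N. \<Sum>k<n. b k * (L k N - glaisher_p N k)) \<longlonglongrightarrow> (\<Sum>k<n. b k * ln (glaisher_D k))"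
    unfolding L_def by (intro tendsto_sum tendsto_mult tendsto_const glaisher_D_limit)
  ultimately have "(\<lambda>N. poly P (real N) * ln (real N) + poly Q (real N)) \<longlonglongrightarrow>
        real n * ln_Gamma_moment (n - 1) - 0 - (\<Sum>k<n. b k * ln (glaisher_D k))"
    unfolding PQ by (intro tendsto_diff tendsto_const)
  hence "Q = [:real n * ln_Gamma_moment (n - 1) - 0 - (\<Sum>k<n. b k * ln (glaisher_D k)):]"
    by (rule poly_ln_convergent_imp_const[THEN conjunct2])
  hence "poly Q 0 = real n * ln_Gamma_moment (n - 1) - (\<Sum>k<n. b k * ln (glaisher_D k))"
    by simp
  moreover have "poly Q 0 = 0"
    by (simp add: Q_def poly_sum C0 s(1))
  ultimately show ?thesis by (simp add: b_def)
qed

section \<open>Fractional integrals of the logarithmic Gamma function\<close>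

theorem theorem2:
  fixes \<alpha> :: complex
  assumes "Re \<alpha> > 0"
  shows "RL_integral_right 1 \<alpha> log_Gamma 0 =
           1 / Gamma (\<alpha> + 1) *
             (of_real (ln pi)
              - (LINT t:{0..1}|lborel. \<alpha> * complex_of_real t powr (\<alpha> - 1) * of_real (ln (sin (pi * t)))))
           - RL_integral_left 0 \<alpha> log_Gamma 1
       \<and> summable (\<lambda>i. let n = Suc i in (-1) ^ n * (\<alpha> gchoose n) *
            (\<Sum>k=0..n-1. (-1) ^ k * of_nat (n choose k) * of_real (ln (glaisher_D k))))
       \<and> RL_integral_right 1 \<alpha> log_Gamma 0 =
           1 / Gamma (\<alpha> + 1) *
             ((\<Sum>i. let n = Suc i in (-1) ^ n * (\<alpha> gchoose n) *
                 (\<Sum>k=0..n-1. (-1) ^ k * of_nat (n choose k) * of_real (ln (glaisher_D k))))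
              + of_real (ln pi)
              - (LINT t:{0..1}|lborel. \<alpha> * complex_of_real t powr (\<alpha> - 1) * of_real (ln (sin (pi * t)))))"
proof -
  define S where "S i = (let n = Suc i in (-1) ^ n * (\<alpha> gchoose n) *
            (\<Sum>k=0..n-1. (-1) ^ k * of_nat (n choose k) * complex_of_real (ln (glaisher_D k))))" for i
  define X where "X = (LINT t:{0<..<1}|lborel. complex_of_real t powr (\<alpha> - 1) * of_real (ln (Gamma t)))"
  define Y where "Y = (LINT t:{0<..<1}|lborel. complex_of_real (1 - t) powr (\<alpha> - 1) * of_real (ln (Gamma t)))"
  define Z where "Z = (LINT t:{0..1}|lborel. \<alpha> * complex_of_real t powr (\<alpha> - 1) * of_real (ln (sin (pi * t))))"
  have \<alpha>0: "\<alpha> \<noteq> 0" using assms by auto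
  have \<alpha>: "\<alpha> \<notin> \<int>\<^sub>\<le>\<^sub>0" using assms by (auto elim!: nonpos_Ints_cases)
  have Gam: "1 / Gamma \<alpha> = \<alpha> / Gamma (\<alpha> + 1)"
    using \<alpha> \<alpha>0 by (simp add: Gamma_plus1)
  have right: "RL_integral_right 1 \<alpha> log_Gamma 0 = 1 / Gamma (\<alpha> + 1) * (\<alpha> * X)"
    unfolding RL_integral_right_def log_Gamma_def set_integral_Icc_eq_open X_def Gam by simp
  have left: "RL_integral_left 0 \<alpha> log_Gamma 1 = 1 / Gamma (\<alpha> + 1) * (\<alpha> * Y)"
    unfolding RL_integral_left_def log_Gamma_def set_integral_Icc_eq_open Y_def Gam by simp
  have XYZ: "\<alpha> * X + \<alpha> * Y = of_real (ln pi) - Z"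
  proof -
    let ?p = "\<lambda>t. complex_of_real t powr (\<alpha> - 1)"
    have intY: "set_integrable lborel {0<..<1} (\<lambda>t. ?p t * of_real (ln (Gamma (1 - t))))"
      using one_minus_powr_ln_Gamma_series(1)[OF assms]
        set_integral_reflect_unit_interval(2)[of "\<lambda>t. complex_of_real (1 - t) powr (\<alpha> - 1) * of_real (ln (Gamma t))"]
      by simp
    have Y: "Y = (LINT t:{0<..<1}|lborel. ?p t * of_real (ln (Gamma (1 - t))))"
      unfolding Y_def
      using set_integral_reflect_unit_interval(1)[of "\<lambda>t. complex_of_real (1 - t) powr (\<alpha> - 1) * of_real (ln (Gamma t))"]
      by simp
    note intX = powr_ln_Gamma_integrable[OF assms]
    note intP = powr_integral_unit_interval[OF assms]
    have integrand: "\<alpha> * ?p t * of_real (ln (sin (pi * t))) = \<alpha> * (of_real (ln pi) * ?p t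
        - ?p t * of_real (ln (Gamma t)) - ?p t * of_real (ln (Gamma (1 - t))))"
      if "t \<in> {0<..<1}" for t
      using that by (subst ln_sin_pi_eq_ln_Gamma) (auto simp: algebra_simps)
    have "Z = (LINT t:{0<..<1}|lborel. \<alpha> * (of_real (ln pi) * ?p t - ?p t * of_real (ln (Gamma t))
               - ?p t * of_real (ln (Gamma (1 - t)))))"
      unfolding Z_def set_integral_Icc_eq_open
      by (intro set_lebesgue_integral_cong) (simp_all add: integrand)
    also have "\<dots> = \<alpha> * (of_real (ln pi) * (1 / \<alpha>) - X - Y)"
      using intX intY intP by (simp add: X_def Y set_integral_diff)
    finally show ?thesis using \<alpha>0 by (simp add: algebra_simps)
  qed
  have S_eq: "S i = - \<alpha> * ((-1) ^ i * ((\<alpha> - 1) gchoose i) * of_real (ln_Gamma_moment i))" for i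
  proof -
    have "(\<Sum>k=0..i. (-1) ^ k * of_nat (Suc i choose k) * complex_of_real (ln (glaisher_D k)))
        = complex_of_real (\<Sum>k<Suc i. (-1) ^ k * real (Suc i choose k) * ln (glaisher_D k))"
      by (simp only: lessThan_Suc_atMost atMost_atLeast0) simp
    also have "\<dots> = of_nat (Suc i) * of_real (ln_Gamma_moment i)"
      by (subst ln_Gamma_moment_eq_glaisher [symmetric]) (simp_all del: of_nat_Suc)
    finally have "S i = (-1) ^ Suc i * (of_nat (Suc i) * (\<alpha> gchoose Suc i)) * of_real (ln_Gamma_moment i)"
      by (simp add: S_def Let_def mult_ac del: of_nat_Suc)
    thus ?thesis unfolding gbinomial_absorption by simp
  qed
  have "S sums (- \<alpha> * Y)"
    unfolding S_eq [abs_def] Y_def by (intro sums_mult one_minus_powr_ln_Gamma_series(2) assms)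
  hence S: "summable S" "suminf S = - (\<alpha> * Y)"
    by (simp_all add: sums_iff)
  have "RL_integral_right 1 \<alpha> log_Gamma 0 =
          1 / Gamma (\<alpha> + 1) * (of_real (ln pi) - Z) - RL_integral_left 0 \<alpha> log_Gamma 1"
    unfolding right left XYZ [symmetric] by (simp add: algebra_simps)
  moreover have "RL_integral_right 1 \<alpha> log_Gamma 0 =
          1 / Gamma (\<alpha> + 1) * (suminf S + of_real (ln pi) - Z)"
  proof -
    have "\<alpha> * X = suminf S + of_real (ln pi) - Z"
      using XYZ S(2) by (simp add: algebra_simps)
    thus ?thesis by (simp only: right)
  qed
  ultimately show ?thesis
    using S(1) unfolding S_def Z_def by blast
qed

end
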